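(* The bilinear form $a$ satisfies the inf-sup estimate $$\inf_{0\ne\mathbf{u}\in H(\mathrm{div})\times L^2}\ \sup_{0\ne\mathbf{v}\in H(\mathrm{div})\times L^2}\ \frac{a(\mathbf{u},\mathbf{v})}{|||\mathbf{u}|||\,|||\mathbf{v}|||}\ \ge\ \frac{\sqrt{3}}{6}.$$
   Context: Let $\Omega$ be an oriented two-dimensional (Riemannian) surface, for instance an open subset of $\mathbb{R}^2$. Write $(\cdot,\cdot)$ and $\|\cdot\|$ for the $L^2(\Omega)$ inner product and norm of (real) scalar functions or tangent vector fields. $L^2=L^2(\Omega)$, and $H(\mathrm{div})$ is the space of square-integrable tangent vector fields $u$ on $\Omega$ with weak divergence $\nabla\cdot u\in L^2$. For a vector field $u=(u_1,u_2)$, $u^\perp=(-u_2,u_1)$ is its pointwise rotation by $\pi/2$. Parameters: real constants $k>0$ (half the time step), $\epsilon>0$ (Rossby number), $\beta>0$ (Burger number). Coefficients: real measurable functions on $\Omega$: $H$ with $H(x)\ge H_*$ for a constant $H_*>0$ (depth); $f$ with $|f(x)|\le 1$ (Coriolis parameter); $C$ with $0\le C(x)\le C^*$ for a finite constant $C^*$ (damping). Bilinear form: for $\mathbf{u}=(u,\eta)$, $\mathbf{v}=(v,w)$ in $H(\mathrm{div})\times L^2$, $$a(\mathbf{u},\mathbf{v})=\left(\tfrac{1}{H}u,v\right)+\left(\tfrac{fk}{\epsilon H}u^\perp,v\right)-\tfrac{\beta k}{\epsilon^2}(\eta,\nabla\cdot v)+\left(\tfrac{Ck}{H}u,v\right)+\tfrac{\beta}{\epsilon^2}(\eta,w)+\tfrac{\beta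 k}{\epsilon^2}(\nabla\cdot u,w).$$ Weighted norm: $$|||\mathbf{u}|||^2=\left(\tfrac{1+Ck}{H}u,u\right)+\tfrac{k^2\beta}{\epsilon^2}\|\nabla\cdot u\|^2+\tfrac{\beta}{\epsilon^2}\|\eta\|^2 .$$ *)

theory Defs
  imports "HOL-Analysis.Analysis"
begin

section \<open>Smooth functions on open subsets of the plane\<close>

primrec Ck_on :: "nat \<Rightarrow> (real^2) set \<Rightarrow> (real^2 \<Rightarrow> real) \<Rightarrow> bool" where
  "Ck_on 0 S h \<longleftrightarrow> continuous_on S h"
| "Ck_on (Suc n) S h \<longleftrightarrow> (\<forall>x\<in>S. h differentiable (at x)) \<and>
     (\<forall>i. Ck_on n S (\<lambda>x. frechet_derivative h (at x) (axis i 1)))"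

definition smooth_on :: "(real^2) set \<Rightarrow> (real^2 \<Rightarrow> real) \<Rightarrow> bool" where
  "smooth_on S h \<longleftrightarrow> (\<forall>n. Ck_on n S h)"


section \<open>Oriented Riemannian surfaces\<close>

text \<open>A chart is a coordinate domain together with its coordinate map. The metric assigns to
  a chart and a point of its domain the Gram matrix of the coordinate basis.\<close>

type_synonym 'a chart = "'a set \<times> ('a \<Rightarrow> real^2)"

record 'a surface =
  topo :: "'a topology"
  atlas :: "'a chart set"
  metric :: "'a chart \<Rightarrow> 'a \<Rightarrow> real^2^2"
  area :: "'a measure"

abbreviation cinv :: "'a chart \<Rightarrow> real^2 \<Rightarrow> 'a" where
  "cinv c \<equiv> the_inv_into (fst c) (snd c)"

definition transition :: "'a chart \<Rightarrow> 'a chart \<Rightarrow> real^2 \<Rightarrow> real^2" where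
  "transition c c' = snd c' \<circ> cinv c"

definition jac :: "'a chart \<Rightarrow> 'a chart \<Rightarrow> 'a \<Rightarrow> real^2^2" where
  "jac c c' p = matrix (frechet_derivative (transition c c') (at (snd c p)))"

text \<open>The three area axioms determine \<^term>\<open>area \<Omega>\<close> uniquely: it is the (complete) Riemannian
  area measure, with density \<open>sqrt (det g)\<close> with respect to Lebesgue measure in every chart.\<close>

locale oriented_riemannian_surface =
  fixes \<Omega> :: "'a surface"
  assumes hausdorff: "Hausdorff_space (topo \<Omega>)"
    and second_countable: "second_countable (topo \<Omega>)"
    and chart_domain: "c \<in> atlas \<Omega> \<Longrightarrow> openin (topo \<Omega>) (fst c)"
    and chart_image: "c \<in> atlas \<Omega> \<Longrightarrow> open (snd c ` fst c)"
    and chart_homeo: "c \<in> atlas \<Omega> \<Longrightarrow>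
      homeomorphic_map (subtopology (topo \<Omega>) (fst c)) (top_of_set (snd c ` fst c)) (snd c)"
    and atlas_cover: "(\<Union>c\<in>atlas \<Omega>. fst c) = topspace (topo \<Omega>)"
    and transition_smooth: "c \<in> atlas \<Omega> \<Longrightarrow> c' \<in> atlas \<Omega> \<Longrightarrow>
      smooth_on (snd c ` (fst c \<inter> fst c')) (\<lambda>x. transition c c' x $ i)"
    and transition_oriented: "c \<in> atlas \<Omega> \<Longrightarrow> c' \<in> atlas \<Omega> \<Longrightarrow> p \<in> fst c \<inter> fst c' \<Longrightarrow>
      det (jac c c' p) > 0"
    and metric_smooth: "c \<in> atlas \<Omega> \<Longrightarrow>
      smooth_on (snd c ` fst c) (\<lambda>x. metric \<Omega> c (cinv c x) $ i $ j)"
    and metric_sym: "c \<in> atlas \<Omega> \<Longrightarrow> p \<in> fst c \<Longrightarrow> transpose (metric \<Omega> c p) = metric \<Omega> c p"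
    and metric_pos: "c \<in> atlas \<Omega> \<Longrightarrow> p \<in> fst c \<Longrightarrow> \<xi> \<noteq> 0 \<Longrightarrow> \<xi> \<bullet> (metric \<Omega> c p *v \<xi>) > 0"
    and metric_change: "c \<in> atlas \<Omega> \<Longrightarrow> c' \<in> atlas \<Omega> \<Longrightarrow> p \<in> fst c \<inter> fst c' \<Longrightarrow>
      metric \<Omega> c p = transpose (jac c c' p) ** metric \<Omega> c' p ** jac c c' p"
    and area_space: "space (area \<Omega>) = topspace (topo \<Omega>)"
    and area_sets: "sets (area \<Omega>) =
      {A. A \<subseteq> topspace (topo \<Omega>) \<and> (\<forall>c\<in>atlas \<Omega>. snd c ` (A \<inter> fst c) \<in> sets lebesgue)}"
    and area_chart: "c \<in> atlas \<Omega> \<Longrightarrow> A \<in> sets (area \<Omega>) \<Longrightarrow> A \<subseteq> fst c \<Longrightarrow>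
      emeasure (area \<Omega>) A =
        (\<integral>\<^sup>+x\<in>snd c ` A. ennreal (sqrt (det (metric \<Omega> c (cinv c x)))) \<partial>lebesgue)"


section \<open>Tangent vectors\<close>

text \<open>A tangent vector at \<open>p\<close> is the family of its component vectors in all charts around \<open>p\<close>
  (set to 0 in all other charts, so that equality of tangent vectors is equality of
  families). A vector field maps points to such families.\<close>

type_synonym 'a tvec = "'a chart \<Rightarrow> real^2"

definition charts_at :: "'a surface \<Rightarrow> 'a \<Rightarrow> 'a chart set" where
  "charts_at \<Omega> p = {c \<in> atlas \<Omega>. p \<in> fst c}"

definition chart_at :: "'a surface \<Rightarrow> 'a \<Rightarrow> 'a chart" where
  "chart_at \<Omega> p = (SOME c. c \<in> charts_at \<Omega> p)"

definition tangent_space :: "'a surface \<Rightarrow> 'a \<Rightarrow> 'a tvec set" where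
  "tangent_space \<Omega> p = {\<xi>.
     (\<forall>c\<in>charts_at \<Omega> p. \<forall>c'\<in>charts_at \<Omega> p. \<xi> c' = jac c c' p *v \<xi> c) \<and>
     (\<forall>c. c \<notin> charts_at \<Omega> p \<longrightarrow> \<xi> c = 0)}"

text \<open>By the transformation laws, \<open>tinner\<close> and \<open>dird\<close> (the derivative of a function in the
  direction of a tangent vector) do not depend on the chart chosen by \<^const>\<open>chart_at\<close>.\<close>

definition tinner :: "'a surface \<Rightarrow> 'a \<Rightarrow> 'a tvec \<Rightarrow> 'a tvec \<Rightarrow> real" where
  "tinner \<Omega> p \<xi> \<zeta> = (let c = chart_at \<Omega> p in \<xi> c \<bullet> (metric \<Omega> c p *v \<zeta> c))"

definition dird :: "'a surface \<Rightarrow> 'a \<Rightarrow> ('a \<Rightarrow> real) \<Rightarrow> 'a tvec \<Rightarrow> real" where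
  "dird \<Omega> p \<phi> \<xi> = (let c = chart_at \<Omega> p in
     frechet_derivative (\<phi> \<circ> cinv c) (at (snd c p)) (\<xi> c))"

text \<open>Rotation by \<open>\<pi>/2\<close> in the oriented Euclidean plane \<open>T\<^sub>p\<Omega>\<close>: with \<open>g\<close> the Gram matrix in a
  positively oriented chart and \<open>w = g \<xi>\<close>, the rotated vector has components
  \<open>(-w\<^sub>2, w\<^sub>1) / sqrt (det g)\<close>; it is orthogonal to \<open>\<xi>\<close>, has the same length, and makes
  \<open>(\<xi>, \<xi>\<^sup>\<bottom>)\<close> positively oriented. For \<open>g = 1\<close> this is \<open>(-\<xi>\<^sub>2, \<xi>\<^sub>1)\<close>.\<close>

definition rot :: "'a surface \<Rightarrow> 'a \<Rightarrow> 'a tvec \<Rightarrow> 'a tvec" where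
  "rot \<Omega> p \<xi> = (\<lambda>c. if c \<in> charts_at \<Omega> p
     then (let w = metric \<Omega> c p *v \<xi> c
           in (1 / sqrt (det (metric \<Omega> c p))) *\<^sub>R vector [- (w $ 2), w $ 1])
     else 0)"

definition perp :: "'a surface \<Rightarrow> ('a \<Rightarrow> 'a tvec) \<Rightarrow> ('a \<Rightarrow> 'a tvec)" where
  "perp \<Omega> u = (\<lambda>p. rot \<Omega> p (u p))"

definition fscale :: "('a \<Rightarrow> real) \<Rightarrow> ('a \<Rightarrow> 'a tvec) \<Rightarrow> ('a \<Rightarrow> 'a tvec)" where
  "fscale s u = (\<lambda>p c. s p *\<^sub>R u p c)"


section \<open>Square-integrable functions and fields, weak divergence\<close>

text \<open>Elements of \<open>L\<^sup>2\<close> and \<open>H(div)\<close> are given by representatives; being zero is understood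
  almost everywhere.\<close>

definition L2 :: "'a surface \<Rightarrow> ('a \<Rightarrow> real) set" where
  "L2 \<Omega> = {h. h \<in> borel_measurable (area \<Omega>) \<and> integrable (area \<Omega>) (\<lambda>p. (h p)\<^sup>2)}"

definition L2_field :: "'a surface \<Rightarrow> ('a \<Rightarrow> 'a tvec) set" where
  "L2_field \<Omega> = {u.
     (\<forall>p\<in>topspace (topo \<Omega>). u p \<in> tangent_space \<Omega> p) \<and>
     (\<forall>c\<in>atlas \<Omega>. (\<lambda>p. u p c) \<in> borel_measurable (restrict_space (area \<Omega>) (fst c))) \<and>
     integrable (area \<Omega>) (\<lambda>p. tinner \<Omega> p (u p) (u p))}"

definition ip :: "'a surface \<Rightarrow> ('a \<Rightarrow> real) \<Rightarrow> ('a \<Rightarrow> real) \<Rightarrow> real" where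
  "ip \<Omega> h h' = (LINT p|area \<Omega>. h p * h' p)"

definition ip_field :: "'a surface \<Rightarrow> ('a \<Rightarrow> 'a tvec) \<Rightarrow> ('a \<Rightarrow> 'a tvec) \<Rightarrow> real" where
  "ip_field \<Omega> u v = (LINT p|area \<Omega>. tinner \<Omega> p (u p) (v p))"

definition test_functions :: "'a surface \<Rightarrow> ('a \<Rightarrow> real) set" where
  "test_functions \<Omega> = {\<phi>.
     (\<forall>c\<in>atlas \<Omega>. smooth_on (snd c ` fst c) (\<phi> \<circ> cinv c)) \<and>
     (\<exists>K. compactin (topo \<Omega>) K \<and> (\<forall>p\<in>topspace (topo \<Omega>) - K. \<phi> p = 0))}"

definition has_weak_div :: "'a surface \<Rightarrow> ('a \<Rightarrow> 'a tvec) \<Rightarrow> ('a \<Rightarrow> real) \<Rightarrow> bool" where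
  "has_weak_div \<Omega> u d \<longleftrightarrow>
     (\<forall>\<phi>\<in>test_functions \<Omega>.
        (LINT p|area \<Omega>. d p * \<phi> p) = - (LINT p|area \<Omega>. dird \<Omega> p \<phi> (u p)))"

definition Hdiv :: "'a surface \<Rightarrow> ('a \<Rightarrow> 'a tvec) set" where
  "Hdiv \<Omega> = {u \<in> L2_field \<Omega>. \<exists>d\<in>L2 \<Omega>. has_weak_div \<Omega> u d}"

text \<open>Unique up to a null set for \<open>u\<close> in \<open>Hdiv \<Omega>\<close>.\<close>

definition divg :: "'a surface \<Rightarrow> ('a \<Rightarrow> 'a tvec) \<Rightarrow> ('a \<Rightarrow> real)" where
  "divg \<Omega> u = (SOME d. d \<in> L2 \<Omega> \<and> has_weak_div \<Omega> u d)"

type_synonym 'a state = "('a \<Rightarrow> 'a tvec) \<times> ('a \<Rightarrow> real)"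

definition nonzero_states :: "'a surface \<Rightarrow> 'a state set" where
  "nonzero_states \<Omega> = {(u, \<eta>). u \<in> Hdiv \<Omega> \<and> \<eta> \<in> L2 \<Omega> \<and>
     \<not> (AE p in area \<Omega>. u p = (\<lambda>_. 0) \<and> \<eta> p = 0)}"


section \<open>The bilinear form and the weighted norm\<close>

definition bilin :: "'a surface \<Rightarrow> real \<Rightarrow> real \<Rightarrow> real \<Rightarrow>
    ('a \<Rightarrow> real) \<Rightarrow> ('a \<Rightarrow> real) \<Rightarrow> ('a \<Rightarrow> real) \<Rightarrow> 'a state \<Rightarrow> 'a state \<Rightarrow> real" where
  "bilin \<Omega> k \<epsilon> \<beta> H f C U V = (case (U, V) of ((u, \<eta>), (v, w)) \<Rightarrow>
     ip_field \<Omega> (fscale (\<lambda>p. 1 / H p) u) v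
     + ip_field \<Omega> (fscale (\<lambda>p. f p * k / (\<epsilon> * H p)) (perp \<Omega> u)) v
     - \<beta> * k / \<epsilon>\<^sup>2 * ip \<Omega> \<eta> (divg \<Omega> v)
     + ip_field \<Omega> (fscale (\<lambda>p. C p * k / H p) u) v
     + \<beta> / \<epsilon>\<^sup>2 * ip \<Omega> \<eta> w
     + \<beta> * k / \<epsilon>\<^sup>2 * ip \<Omega> (divg \<Omega> u) w)"

definition wnorm :: "'a surface \<Rightarrow> real \<Rightarrow> real \<Rightarrow> real \<Rightarrow>
    ('a \<Rightarrow> real) \<Rightarrow> ('a \<Rightarrow> real) \<Rightarrow> 'a state \<Rightarrow> real" where
  "wnorm \<Omega> k \<epsilon> \<beta> H C U = (case U of (u, \<eta>) \<Rightarrow>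
     sqrt (ip_field \<Omega> (fscale (\<lambda>p. (1 + C p * k) / H p) u) u
           + k\<^sup>2 * \<beta> / \<epsilon>\<^sup>2 * ip \<Omega> (divg \<Omega> u) (divg \<Omega> u)
           + \<beta> / \<epsilon>\<^sup>2 * ip \<Omega> \<eta> \<eta>))"

end

theory Submission
  imports Defs
begin

text \<open>Testing \<open>a((u, \<eta>), \<cdot>)\<close> with \<open>(u, \<eta> + k \<nabla>\<cdot>u)\<close> kills the Coriolis term, which is skew.
  Writing \<open>|||(u, \<eta>)|||\<^sup>2 = A + D + E\<close> for the three terms of the weighted norm, and \<open>N\<close> for the
  third term with \<open>\<eta> + k \<nabla>\<cdot>u\<close> in place of \<open>\<eta>\<close>, the form takes the value
  \<open>A + (D + E) / 2 + N / 2 \<ge> |||(u, \<eta>)|||\<^sup>2 / 2\<close>, while the test function has squared norm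
  \<open>A + D + N \<le> 3 |||(u, \<eta>)|||\<^sup>2\<close>, since \<open>N \<le> 2 (D + E)\<close>. The quotient is therefore at least
  \<open>1 / (2 sqrt 3) = sqrt 3 / 6\<close>.\<close>

section \<open>Arithmetic of the quotient\<close>

text \<open>\<open>S\<close> and \<open>T\<close> play the squared norms of the given state and of
  the test state, \<open>a\<close> the value of the form. The geometric mean of \<open>S\<close> and
  \<open>T\<close> is at most \<open>sqrt 3 * S\<close>, while \<open>a\<close> is at least
  \<open>S / 2\<close>.\<close>

lemma quotient_bound:
  fixes S T a :: real
  assumes "0 < S" "0 < T" "S / 2 \<le> a" "T \<le> 3 * S"
  shows "sqrt 3 / 6 \<le> a / (sqrt S * sqrt T)"
proof -
  have "sqrt T \<le> sqrt 3 * sqrt S"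
    using assms(4) by (metis real_sqrt_le_mono real_sqrt_mult)
  then have "sqrt S * sqrt T \<le> sqrt S * (sqrt 3 * sqrt S)"
    using assms(1) by (intro mult_left_mono) simp_all
  also have "\<dots> = sqrt 3 * (sqrt S * sqrt S)"
    by (simp only: mult_ac)
  also have "sqrt S * sqrt S = S"
    using assms(1) by simp
  finally have "sqrt 3 / 6 * (sqrt S * sqrt T) \<le> sqrt 3 / 6 * (sqrt 3 * S)"
    by (rule mult_left_mono) simp
  also have "\<dots> = sqrt 3 * sqrt 3 / 6 * S"
    by (simp only: times_divide_eq_left times_divide_eq_right mult_ac)
  also have "\<dots> = S / 2"
    by simp
  also have "\<dots> \<le> a"
    by (rule assms(3))
  finally show ?thesis
    using assms(1,2) by (simp only: pos_le_divide_eq mult_pos_pos real_sqrt_gt_0_iff)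
qed

section \<open>Pointwise algebra of tangent vectors\<close>

lemma tinner_fscale: "tinner \<Omega> p (fscale s u p) \<xi> = s p * tinner \<Omega> p (u p) \<xi>"
  by (simp add: tinner_def fscale_def Let_def)

lemma tinner_zero [simp]: "tinner \<Omega> p (\<lambda>_. 0) \<xi> = 0"
  by (simp add: tinner_def Let_def)

text \<open>In the chosen chart, with \<open>w\<close> the metric applied to \<open>\<xi>\<close>,
  the pairing is a multiple of \<open>- w2 w1 + w1 w2\<close>. Where \<open>chart_at\<close> falls
  outside \<open>charts_at\<close>, the default value 0 of \<open>rot\<close> gives the
  same.\<close>

lemma tinner_rot_self: "tinner \<Omega> p (rot \<Omega> p \<xi>) \<xi> = 0"
  by (simp add: tinner_def rot_def Let_def inner_vec_def sum_2 vector_2)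

section \<open>The L^2 inner product of scalar functions\<close>

lemma L2_mult_integrable:
  assumes "h \<in> L2 \<Omega>" "h' \<in> L2 \<Omega>"
  shows "integrable (area \<Omega>) (\<lambda>p. h p * h' p)"
proof (rule Bochner_Integration.integrable_bound)
  show "integrable (area \<Omega>) (\<lambda>p. (h p)\<^sup>2 + (h' p)\<^sup>2)"
    using assms by (auto simp: L2_def)
  show "(\<lambda>p. h p * h' p) \<in> borel_measurable (area \<Omega>)"
    using assms by (auto simp: L2_def)
  have "\<bar>x * y\<bar> \<le> x\<^sup>2 + y\<^sup>2" for x y :: real
  proof -
    have "2 * \<bar>x\<bar> * \<bar>y\<bar> \<le> \<bar>x\<bar>\<^sup>2 + \<bar>y\<bar>\<^sup>2"
      by (rule sum_squares_bound)
    moreover have "0 \<le> \<bar>x\<bar> * \<bar>y\<bar>"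
      by simp
    ultimately show ?thesis
      unfolding abs_mult power2_abs by linarith
  qed
  then show "AE p in area \<Omega>. norm (h p * h' p) \<le> norm ((h p)\<^sup>2 + (h' p)\<^sup>2)"
    by simp
qed

lemma L2_add_scaled:
  assumes "h \<in> L2 \<Omega>" "h' \<in> L2 \<Omega>"
  shows "(\<lambda>p. h p + c * h' p) \<in> L2 \<Omega>"
proof -
  have "integrable (area \<Omega>) (\<lambda>p. (h p)\<^sup>2 + 2 * c * (h p * h' p) + c\<^sup>2 * (h' p)\<^sup>2)"
    using assms L2_mult_integrable[OF assms] by (auto simp: L2_def)
  also have "(\<lambda>p. (h p)\<^sup>2 + 2 * c * (h p * h' p) + c\<^sup>2 * (h' p)\<^sup>2) = (\<lambda>p. (h p + c * h' p)\<^sup>2)"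
    by (simp add: fun_eq_iff power2_eq_square algebra_simps)
  finally show ?thesis
    using assms by (auto simp: L2_def)
qed

lemma ip_commute: "ip \<Omega> h h' = ip \<Omega> h' h"
  by (simp add: ip_def mult.commute)

lemma ip_add_scaled_right:
  assumes "g \<in> L2 \<Omega>" "h \<in> L2 \<Omega>" "h' \<in> L2 \<Omega>"
  shows "ip \<Omega> g (\<lambda>p. h p + c * h' p) = ip \<Omega> g h + c * ip \<Omega> g h'"
proof -
  have "ip \<Omega> g (\<lambda>p. h p + c * h' p) = (LINT p|area \<Omega>. g p * h p + c * (g p * h' p))"
    by (simp add: ip_def algebra_simps)
  then show ?thesis
    using L2_mult_integrable[of g] assms by (simp add: ip_def)
qed

text \<open>Used twice: \<open>c = k\<close> expands the third norm term of the test state; with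
  \<open>c = - k\<close>, nonnegativity of the left side bounds the cross term from above.\<close>

lemma ip_self_add_scaled:
  assumes "h \<in> L2 \<Omega>" "h' \<in> L2 \<Omega>"
  shows "ip \<Omega> (\<lambda>p. h p + c * h' p) (\<lambda>p. h p + c * h' p)
    = ip \<Omega> h h + 2 * c * ip \<Omega> h h' + c\<^sup>2 * ip \<Omega> h' h'"
proof -
  let ?g = "\<lambda>p. h p + c * h' p"
  have "ip \<Omega> ?g ?g = ip \<Omega> h ?g + c * ip \<Omega> h' ?g"
    using ip_add_scaled_right[OF L2_add_scaled[OF assms] assms]
    by (simp only: ip_commute[of \<Omega> ?g h] ip_commute[of \<Omega> ?g h'])
  then show ?thesis
    using assms
    by (simp add: ip_add_scaled_right ip_commute[of _ h' h] power2_eq_square algebra_simps)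
qed

lemma ip_self_nonneg: "ip \<Omega> h h \<ge> 0"
  by (simp add: ip_def)

lemma ip_self_eq_0:
  assumes "h \<in> L2 \<Omega>" "ip \<Omega> h h = 0"
  shows "AE p in area \<Omega>. h p = 0"
  using assms L2_mult_integrable[OF assms(1,1)]
  by (simp add: ip_def integral_nonneg_eq_0_iff_AE)

lemma divg_in_L2:
  assumes "u \<in> Hdiv \<Omega>"
  shows "divg \<Omega> u \<in> L2 \<Omega>"
proof -
  have "\<exists>d. d \<in> L2 \<Omega> \<and> has_weak_div \<Omega> u d"
    using assms by (auto simp: Hdiv_def)
  then show ?thesis
    unfolding divg_def by (rule someI2_ex) simp
qed

section \<open>Definiteness of weighted L^2 norms of vector fields\<close>

context oriented_riemannian_surface
begin

lemma chart_at_in_charts_at: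
  assumes "p \<in> topspace (topo \<Omega>)"
  shows "chart_at \<Omega> p \<in> charts_at \<Omega> p"
proof -
  have "\<exists>c. c \<in> charts_at \<Omega> p"
    using assms unfolding charts_at_def atlas_cover[symmetric] by blast
  then show ?thesis
    unfolding chart_at_def by (rule someI_ex)
qed

text \<open>By the transformation law one chart determines a tangent vector, its entries for charts
  away from \<open>p\<close> being 0 by convention. So a nonzero vector has nonzero components in
  \<open>chart_at\<close>, where the metric is positive definite.\<close>

lemma tinner_pos:
  assumes p: "p \<in> topspace (topo \<Omega>)" and \<xi>: "\<xi> \<in> tangent_space \<Omega> p" "\<xi> \<noteq> (\<lambda>_. 0)"
  shows "tinner \<Omega> p \<xi> \<xi> > 0"
proof -
  let ?c = "chart_at \<Omega> p"
  have c: "?c \<in> charts_at \<Omega> p"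
    using p by (rule chart_at_in_charts_at)
  have "\<xi> ?c \<noteq> 0"
  proof
    assume 0: "\<xi> ?c = 0"
    have "\<xi> c' = 0" for c'
    proof (cases "c' \<in> charts_at \<Omega> p")
      case True
      then have "\<xi> c' = jac ?c c' p *v \<xi> ?c"
        using \<xi>(1) c unfolding tangent_space_def by blast
      then show ?thesis by (simp add: 0)
    next
      case False
      then show ?thesis using \<xi>(1) unfolding tangent_space_def by blast
    qed
    then show False using \<xi>(2) by auto
  qed
  then show ?thesis
    using c metric_pos by (simp add: tinner_def Let_def charts_at_def)
qed

lemma tinner_nonneg:
  assumes "p \<in> topspace (topo \<Omega>)" "\<xi> \<in> tangent_space \<Omega> p"
  shows "tinner \<Omega> p \<xi> \<xi> \<ge> 0"
  using tinner_pos[OF assms] by (cases "\<xi> = (\<lambda>_. 0)") auto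

text \<open>Integrability must be known before integrals are split or their vanishing is exploited,
  since a nonintegrable function has Bochner integral 0.\<close>

lemma weighted_tinner_integrable:
  assumes u: "u \<in> L2_field \<Omega>"
    and s: "s \<in> borel_measurable (area \<Omega>)" "\<And>p. p \<in> topspace (topo \<Omega>) \<Longrightarrow> \<bar>s p\<bar> \<le> B"
  shows "integrable (area \<Omega>) (\<lambda>p. s p * tinner \<Omega> p (u p) (u p))"
proof (rule Bochner_Integration.integrable_bound)
  have int: "integrable (area \<Omega>) (\<lambda>p. tinner \<Omega> p (u p) (u p))"
    using u by (simp add: L2_field_def)
  then show "integrable (area \<Omega>) (\<lambda>p. B * tinner \<Omega> p (u p) (u p))"
    by simp
  show "(\<lambda>p. s p * tinner \<Omega> p (u p) (u p)) \<in> borel_measurable (area \<Omega>)"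
    using s(1) borel_measurable_integrable[OF int] by (rule borel_measurable_times)
  show "AE p in area \<Omega>. norm (s p * tinner \<Omega> p (u p) (u p)) \<le> norm (B * tinner \<Omega> p (u p) (u p))"
  proof (rule AE_I2)
    fix p assume "p \<in> space (area \<Omega>)"
    then have "\<bar>s p\<bar> \<le> \<bar>B\<bar>"
      using s(2)[of p] by (auto simp: area_space)
    then show "norm (s p * tinner \<Omega> p (u p) (u p)) \<le> norm (B * tinner \<Omega> p (u p) (u p))"
      by (simp add: abs_mult mult_right_mono)
  qed
qed

lemma ip_field_fscale_self_nonneg:
  assumes "u \<in> L2_field \<Omega>" "\<And>p. p \<in> topspace (topo \<Omega>) \<Longrightarrow> s p \<ge> 0"
  shows "ip_field \<Omega> (fscale s u) u \<ge> 0"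
  unfolding ip_field_def tinner_fscale
proof (rule integral_nonneg_AE, rule AE_I2)
  fix p assume "p \<in> space (area \<Omega>)"
  then show "0 \<le> s p * tinner \<Omega> p (u p) (u p)"
    using assms by (intro mult_nonneg_nonneg tinner_nonneg) (simp_all add: area_space L2_field_def)
qed

text \<open>A nonnegative integrable function with integral 0 vanishes almost everywhere; strict
  positivity of \<open>s\<close> and \<open>tinner_pos\<close> carry this over to \<open>u\<close>.
  The bound \<open>B\<close> provides the integrability.\<close>

lemma ip_field_fscale_self_eq_0:
  assumes u: "u \<in> L2_field \<Omega>"
    and s: "s \<in> borel_measurable (area \<Omega>)" "\<And>p. p \<in> topspace (topo \<Omega>) \<Longrightarrow> 0 < s p \<and> s p \<le> B"
    and 0: "ip_field \<Omega> (fscale s u) u = 0"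
  shows "AE p in area \<Omega>. u p = (\<lambda>_. 0)"
proof -
  have tangent: "u p \<in> tangent_space \<Omega> p" if "p \<in> topspace (topo \<Omega>)" for p
    using u that by (auto simp: L2_field_def)
  have "\<bar>s p\<bar> \<le> B" if "p \<in> topspace (topo \<Omega>)" for p
    using s(2)[OF that] by simp
  then have "integrable (area \<Omega>) (\<lambda>p. s p * tinner \<Omega> p (u p) (u p))"
    by (rule weighted_tinner_integrable[OF u s(1)])
  moreover have "AE p in area \<Omega>. 0 \<le> s p * tinner \<Omega> p (u p) (u p)"
  proof (rule AE_I2)
    fix p assume "p \<in> space (area \<Omega>)"
    then have "p \<in> topspace (topo \<Omega>)"
      by (simp add: area_space)
    then show "0 \<le> s p * tinner \<Omega> p (u p) (u p)"
      using s(2) by (intro mult_nonneg_nonneg tinner_nonneg tangent) (simp_all add: less_imp_le)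
  qed
  ultimately have "AE p in area \<Omega>. s p * tinner \<Omega> p (u p) (u p) = 0"
    using 0 by (simp add: ip_field_def tinner_fscale integral_nonneg_eq_0_iff_AE)
  then show ?thesis
  proof (rule AE_mp, intro AE_I2 impI)
    fix p assume p: "p \<in> space (area \<Omega>)" and "s p * tinner \<Omega> p (u p) (u p) = 0"
    then have "tinner \<Omega> p (u p) (u p) = 0"
      using s(2)[of p] by (auto simp: area_space)
    then show "u p = (\<lambda>_. 0)"
      using tinner_pos[of p "u p"] tangent[of p] p by (auto simp: area_space)
  qed
qed

end

text \<open>Serves the degenerate case of \<open>inf_sup_witness\<close>, where \<open>u\<close>
  vanishes almost everywhere.\<close>

lemma ip_field_fscale_AE_0:
  assumes "AE p in area \<Omega>. u p = (\<lambda>_. 0)"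
  shows "ip_field \<Omega> (fscale s u) u = 0"
proof -
  have "AE p in area \<Omega>. tinner \<Omega> p (fscale s u p) (u p) = 0"
    using assms by eventually_elim (simp add: tinner_fscale)
  then show ?thesis
    unfolding ip_field_def by (rule integral_eq_zero_AE)
qed

lemma ip_field_perp_self: "ip_field \<Omega> (fscale s (perp \<Omega> u)) u = 0"
  by (simp add: ip_field_def tinner_fscale perp_def tinner_rot_self)

section \<open>The weighted norm under the depth and damping bounds\<close>

locale shallow_water = oriented_riemannian_surface \<Omega>
  for \<Omega> :: "'a surface" +
  fixes k \<epsilon> \<beta> Hmin Cmax :: real and H C :: "'a \<Rightarrow> real"
  assumes pos: "k > 0" "\<epsilon> > 0" "\<beta> > 0" "Hmin > 0"
    and H_measurable [measurable]: "H \<in> borel_measurable (area \<Omega>)"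
    and H_ge: "p \<in> topspace (topo \<Omega>) \<Longrightarrow> H p \<ge> Hmin"
    and C_measurable [measurable]: "C \<in> borel_measurable (area \<Omega>)"
    and C_bounds: "p \<in> topspace (topo \<Omega>) \<Longrightarrow> 0 \<le> C p \<and> C p \<le> Cmax"
begin

text \<open>Strict positivity gives definiteness of the weighted norm, the upper bound
  integrability; the latter pairs the largest damping with the smallest depth.\<close>

lemma weight_bounds:
  assumes "p \<in> topspace (topo \<Omega>)"
  shows "0 < (1 + C p * k) / H p \<and> (1 + C p * k) / H p \<le> (1 + Cmax * k) / Hmin"
proof
  have "0 < H p" "0 \<le> C p * k" "C p * k \<le> Cmax * k"
    using H_ge[OF assms] C_bounds[OF assms] pos by (auto intro: mult_right_mono)
  then show "0 < (1 + C p * k) / H p"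
    by (intro divide_pos_pos) auto
  show "(1 + C p * k) / H p \<le> (1 + Cmax * k) / Hmin"
    using \<open>0 \<le> C p * k\<close> \<open>C p * k \<le> Cmax * k\<close> H_ge[OF assms] pos
    by (intro frac_le) linarith+
qed

text \<open>The mass and damping terms of the form at \<open>v = u\<close> combine into the first
  term of the squared norm. Both weights are nonnegative, so the bound on their sum makes each
  integral exist.\<close>

lemma weight_split:
  assumes u: "u \<in> L2_field \<Omega>"
  shows "ip_field \<Omega> (fscale (\<lambda>p. 1 / H p) u) u + ip_field \<Omega> (fscale (\<lambda>p. C p * k / H p) u) u
    = ip_field \<Omega> (fscale (\<lambda>p. (1 + C p * k) / H p) u) u"
proof -
  have bounds: "\<bar>1 / H p\<bar> \<le> (1 + Cmax * k) / Hmin" "\<bar>C p * k / H p\<bar> \<le> (1 + Cmax * k) / Hmin"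
    if "p \<in> topspace (topo \<Omega>)" for p
  proof -
    have "0 < H p" "0 \<le> C p * k"
      using H_ge[OF that] C_bounds[OF that] pos by auto
    then have "0 \<le> 1 / H p" "0 \<le> C p * k / H p"
      by simp_all
    moreover have "1 / H p + C p * k / H p \<le> (1 + Cmax * k) / Hmin"
      using weight_bounds[OF that] by (simp add: add_divide_distrib)
    ultimately show "\<bar>1 / H p\<bar> \<le> (1 + Cmax * k) / Hmin"
      "\<bar>C p * k / H p\<bar> \<le> (1 + Cmax * k) / Hmin"
      by linarith+
  qed
  have "integrable (area \<Omega>) (\<lambda>p. 1 / H p * tinner \<Omega> p (u p) (u p))"
    by (rule weighted_tinner_integrable[OF u _ bounds(1)]) auto
  moreover have "integrable (area \<Omega>) (\<lambda>p. C p * k / H p * tinner \<Omega> p (u p) (u p))"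
    by (rule weighted_tinner_integrable[OF u _ bounds(2)]) auto
  ultimately show ?thesis
    unfolding ip_field_def tinner_fscale add_divide_distrib distrib_right
    by (rule Bochner_Integration.integral_add[symmetric])
qed

lemma weighted_ip_field_nonneg:
  assumes "u \<in> L2_field \<Omega>"
  shows "0 \<le> ip_field \<Omega> (fscale (\<lambda>p. (1 + C p * k) / H p) u) u"
  using assms weight_bounds by (intro ip_field_fscale_self_nonneg less_imp_le) blast+

text \<open>Keeps the quotients away from division by 0, which would yield 0. Definiteness makes the
  first or the third term positive; the divergence term can only add.\<close>

lemma wnorm_pos:
  assumes "(u, \<eta>) \<in> nonzero_states \<Omega>"
  shows "wnorm \<Omega> k \<epsilon> \<beta> H C (u, \<eta>) > 0"
proof -
  let ?A = "ip_field \<Omega> (fscale (\<lambda>p. (1 + C p * k) / H p) u) u"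
  have u: "u \<in> L2_field \<Omega>" and \<eta>: "\<eta> \<in> L2 \<Omega>" and
    nonzero: "\<not> (AE p in area \<Omega>. u p = (\<lambda>_. 0) \<and> \<eta> p = 0)"
    using assms by (auto simp: nonzero_states_def Hdiv_def)
  have "?A \<noteq> 0 \<or> ip \<Omega> \<eta> \<eta> \<noteq> 0"
  proof (rule ccontr)
    assume *: "\<not> (?A \<noteq> 0 \<or> ip \<Omega> \<eta> \<eta> \<noteq> 0)"
    have "(\<lambda>p. (1 + C p * k) / H p) \<in> borel_measurable (area \<Omega>)"
      by measurable
    then have "AE p in area \<Omega>. u p = (\<lambda>_. 0)"
      by (rule ip_field_fscale_self_eq_0[OF u]) (use * weight_bounds in blast)+
    moreover have "AE p in area \<Omega>. \<eta> p = 0"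
      using * by (intro ip_self_eq_0[OF \<eta>]) blast
    ultimately have "AE p in area \<Omega>. u p = (\<lambda>_. 0) \<and> \<eta> p = 0"
      by (rule AE_conjI)
    then show False
      using nonzero by blast
  qed
  then have "0 < ?A \<or> 0 < ip \<Omega> \<eta> \<eta>"
    using weighted_ip_field_nonneg[OF u] ip_self_nonneg[of \<Omega> \<eta>] by linarith
  then have "0 < ?A \<or> 0 < \<beta> / \<epsilon>\<^sup>2 * ip \<Omega> \<eta> \<eta>"
    using pos by auto
  moreover have "0 \<le> k\<^sup>2 * \<beta> / \<epsilon>\<^sup>2 * ip \<Omega> (divg \<Omega> u) (divg \<Omega> u)" "0 \<le> \<beta> / \<epsilon>\<^sup>2 * ip \<Omega> \<eta> \<eta>"
    using pos by (intro mult_nonneg_nonneg divide_nonneg_nonneg ip_self_nonneg; simp)+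
  ultimately show ?thesis
    using weighted_ip_field_nonneg[OF u]
    unfolding wnorm_def prod.case real_sqrt_gt_0_iff by linarith
qed

section \<open>The test state and its quotient\<close>

text \<open>A single \<open>V\<close> bounds the supremum from below. It has to be nonzero, hence
  the case split on the natural candidate \<open>(u, \<zeta>)\<close>.\<close>

lemma inf_sup_witness:
  assumes U: "(u, \<eta>) \<in> nonzero_states \<Omega>"
  shows "\<exists>V\<in>nonzero_states \<Omega>. sqrt 3 / 6 \<le> bilin \<Omega> k \<epsilon> \<beta> H f C (u, \<eta>) V
    / (wnorm \<Omega> k \<epsilon> \<beta> H C (u, \<eta>) * wnorm \<Omega> k \<epsilon> \<beta> H C V)"
proof -
  define d where "d = divg \<Omega> u"
  define \<zeta> where "\<zeta> = (\<lambda>p. \<eta> p + k * d p)"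
  define b where "b = \<beta> / \<epsilon>\<^sup>2"
  define A where "A = ip_field \<Omega> (fscale (\<lambda>p. (1 + C p * k) / H p) u) u"
  define D where "D = b * (k\<^sup>2 * ip \<Omega> d d)"
  define E where "E = b * ip \<Omega> \<eta> \<eta>"
  \<comment> \<open>\<open>2 * X\<close> is the mixed term in the expansion of
    \<open>N\<close>.\<close>
  define X where "X = b * (k * ip \<Omega> \<eta> d)"
  define N where "N = b * ip \<Omega> \<zeta> \<zeta>"
  have b: "0 < b"
    using pos by (simp add: b_def)
  have u: "u \<in> Hdiv \<Omega>" "u \<in> L2_field \<Omega>" and \<eta>: "\<eta> \<in> L2 \<Omega>"
    using U by (auto simp: nonzero_states_def Hdiv_def)
  have d: "d \<in> L2 \<Omega>"
    unfolding d_def using u(1) by (rule divg_in_L2)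
  have \<zeta>: "\<zeta> \<in> L2 \<Omega>"
    unfolding \<zeta>_def using \<eta> d by (rule L2_add_scaled)
  have nonneg: "0 \<le> A" "0 \<le> D" "0 \<le> E" "0 \<le> N"
    unfolding A_def D_def E_def N_def
    by (intro weighted_ip_field_nonneg u mult_nonneg_nonneg ip_self_nonneg zero_le_power2
        less_imp_le[OF b])+
  have N: "N = E + D + 2 * X"
    unfolding N_def \<zeta>_def ip_self_add_scaled[OF \<eta> d] E_def D_def X_def
    by (simp add: algebra_simps)
  \<comment> \<open>Young's inequality for the cross term, from the square of
    \<open>\<eta> - k * d\<close>.\<close>
  have "0 \<le> b * ip \<Omega> (\<lambda>p. \<eta> p + (- k) * d p) (\<lambda>p. \<eta> p + (- k) * d p)"
    by (intro mult_nonneg_nonneg ip_self_nonneg less_imp_le[OF b])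
  also have "\<dots> = E + D - 2 * X"
    unfolding ip_self_add_scaled[OF \<eta> d] E_def D_def X_def by (simp add: algebra_simps)
  finally have X: "2 * X \<le> E + D"
    by simp
  have D: "D = k\<^sup>2 * \<beta> / \<epsilon>\<^sup>2 * ip \<Omega> d d"
    by (simp add: D_def b_def)
  have wnorm_u: "wnorm \<Omega> k \<epsilon> \<beta> H C (u, \<eta>) = sqrt (A + D + E)"
    and wnorm_test: "wnorm \<Omega> k \<epsilon> \<beta> H C (u, \<zeta>) = sqrt (A + D + N)"
    unfolding wnorm_def prod.case A_def D E_def N_def d_def b_def by (rule refl)+
  \<comment> \<open>Kept general in \<open>w\<close>, to be used with \<open>\<zeta>\<close> and, in
    the degenerate case, with \<open>\<eta>\<close>. The Coriolis term vanishes, and the pressure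
    term at \<open>v = u\<close> is \<open>- X\<close>.\<close>
  have bilin_u: "bilin \<Omega> k \<epsilon> \<beta> H f C (u, \<eta>) (u, w)
    = A - X + b * ip \<Omega> \<eta> w + b * (k * ip \<Omega> d w)" for w
    using weight_split[OF u(2)]
    by (simp add: bilin_def A_def X_def d_def b_def ip_field_perp_self mult_ac)
  have S: "0 < A + D + E"
    using wnorm_pos[OF U] by (simp add: wnorm_u)
  show ?thesis
  proof (cases "(u, \<zeta>) \<in> nonzero_states \<Omega>")
    case True
    \<comment> \<open>The shift by \<open>k * d\<close> in \<open>\<zeta>\<close> turns the last two
      terms of \<open>bilin_u\<close> into \<open>E + X\<close> and \<open>X + D\<close>; one
      \<open>X\<close> cancels against \<open>- X\<close>.\<close>
    have "bilin \<Omega> k \<epsilon> \<beta> H f C (u, \<eta>) (u, \<zeta>) = A + E + D + X"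
      unfolding bilin_u \<zeta>_def ip_add_scaled_right[OF \<eta> \<eta> d] ip_add_scaled_right[OF d \<eta> d]
        E_def D_def X_def ip_commute[of _ d \<eta>]
      by (simp add: algebra_simps power2_eq_square)
    \<comment> \<open>Nonnegativity of \<open>N\<close> gives \<open>X \<ge> - (D + E) / 2\<close>,
      which costs at most half of \<open>D + E\<close>.\<close>
    then have half: "(A + D + E) / 2 \<le> bilin \<Omega> k \<epsilon> \<beta> H f C (u, \<eta>) (u, \<zeta>)"
      using nonneg N by (simp add: field_simps)
    have "N \<le> 2 * (D + E)"
      using N X by simp
    then have "A + D + N \<le> 3 * (A + D + E)"
      using nonneg by simp
    moreover have "0 < A + D + N"
      using wnorm_pos[OF True] by (simp add: wnorm_test)
    ultimately show ?thesis
      using quotient_bound[OF S _ half, of "A + D + N"] unfolding wnorm_u[symmetric] wnorm_test[symmetric]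
      by (intro bexI[OF _ True]) blast
  next
    \<comment> \<open>Only excluded by uniqueness of the weak divergence; testing with \<open>(u, \<eta>)\<close> itself
      avoids proving that, since here \<open>D = E\<close>.\<close>
    case False
    then have AE: "AE p in area \<Omega>. u p = (\<lambda>_. 0) \<and> \<zeta> p = 0"
      using u \<zeta> by (auto simp: nonzero_states_def)
    have "AE p in area \<Omega>. u p = (\<lambda>_. 0)"
      using AE by eventually_elim simp
    then have A0: "A = 0"
      unfolding A_def by (rule ip_field_fscale_AE_0)
    have "AE p in area \<Omega>. \<eta> p * \<eta> p = k\<^sup>2 * (d p * d p)"
      using AE
    proof eventually_elim
      case (elim p)
      then have "\<eta> p = - (k * d p)" by (simp add: \<zeta>_def)
      then show ?case by (simp add: power2_eq_square)
    qed
    then have "ip \<Omega> \<eta> \<eta> = (LINT p|area \<Omega>. k\<^sup>2 * (d p * d p))"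
      unfolding ip_def using \<eta> d by (intro integral_cong_AE) (auto simp: L2_def)
    then have DE: "D = E"
      by (simp add: D_def E_def ip_def)
    \<comment> \<open>With \<open>w = \<eta>\<close> the cross terms cancel, leaving
      \<open>A + E\<close> with \<open>A = 0\<close>. The squared norm is
      \<open>D + E = 2 * E\<close>, so the quotient is 1/2.\<close>
    have "bilin \<Omega> k \<epsilon> \<beta> H f C (u, \<eta>) (u, \<eta>) = E"
      unfolding bilin_u by (simp add: A0 E_def X_def ip_commute[of _ d \<eta>])
    then have "bilin \<Omega> k \<epsilon> \<beta> H f C (u, \<eta>) (u, \<eta>)
        / (wnorm \<Omega> k \<epsilon> \<beta> H C (u, \<eta>) * wnorm \<Omega> k \<epsilon> \<beta> H C (u, \<eta>)) = 1 / 2"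
      using S by (simp add: wnorm_u A0 DE)
    moreover have "sqrt 3 / 6 \<le> (1 / 2 :: real)"
      using real_sqrt_le_mono[of 3 9] by simp
    ultimately show ?thesis
      by (intro bexI[OF _ U]) linarith
  qed
qed

end

theorem theorem3p2:
  fixes \<Omega> :: "'a surface"
    and k \<epsilon> \<beta> Hmin Cmax :: real
    and H f C :: "'a \<Rightarrow> real"
  assumes "oriented_riemannian_surface \<Omega>"
    and "k > 0" "\<epsilon> > 0" "\<beta> > 0"
    and "H \<in> borel_measurable (area \<Omega>)"
    and "Hmin > 0" "\<forall>p\<in>topspace (topo \<Omega>). H p \<ge> Hmin"
    and "f \<in> borel_measurable (area \<Omega>)"
    and "\<forall>p\<in>topspace (topo \<Omega>). \<bar>f p\<bar> \<le> 1"
    and "C \<in> borel_measurable (area \<Omega>)"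
    and "\<forall>p\<in>topspace (topo \<Omega>). 0 \<le> C p \<and> C p \<le> Cmax"
  shows "(INF U\<in>nonzero_states \<Omega>. SUP V\<in>nonzero_states \<Omega>.
            ereal (bilin \<Omega> k \<epsilon> \<beta> H f C U V
                   / (wnorm \<Omega> k \<epsilon> \<beta> H C U * wnorm \<Omega> k \<epsilon> \<beta> H C V)))
         \<ge> ereal (sqrt 3 / 6)"
proof -
  interpret shallow_water \<Omega> k \<epsilon> \<beta> Hmin Cmax H C
    using assms by (intro shallow_water.intro shallow_water_axioms.intro) auto
  \<comment> \<open>In the complete lattice \<open>ereal\<close> no boundedness has to be shown, and
    the infimum is infinity if there is no nonzero state.\<close>
  show ?thesis
  proof (rule INF_greatest)
    fix U assume U: "U \<in> nonzero_states \<Omega>"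
    obtain V where "V \<in> nonzero_states \<Omega>"
      "sqrt 3 / 6 \<le> bilin \<Omega> k \<epsilon> \<beta> H f C U V
        / (wnorm \<Omega> k \<epsilon> \<beta> H C U * wnorm \<Omega> k \<epsilon> \<beta> H C V)"
      using inf_sup_witness[of "fst U" "snd U", unfolded prod.collapse, OF U, of f] by blast
    then show "ereal (sqrt 3 / 6) \<le> (SUP V\<in>nonzero_states \<Omega>.
        ereal (bilin \<Omega> k \<epsilon> \<beta> H f C U V
               / (wnorm \<Omega> k \<epsilon> \<beta> H C U * wnorm \<Omega> k \<epsilon> \<beta> H C V)))"
      by (intro SUP_upper2[of V]) (simp_all only: ereal_less_eq)
  qed
qed

end
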